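(* Let $\bar\epsilon\in\mathrm{int}(\mathcal{E})$ and let both $\mathcal{P}^*(\epsilon)$ and $\mathcal{D}^*(\epsilon)$ be continuous at $\bar\epsilon$ relative to $\mathrm{int}(\mathcal{E})$. Then, for all $\epsilon$ in a sufficiently small neighborhood of $\bar\epsilon$, we have $$\mathcal{B}(\bar\epsilon)\subseteq\mathcal{B}(\epsilon),\quad \mathcal{N}(\bar\epsilon)\subseteq\mathcal{N}(\epsilon),\quad \mathcal{R}(\bar\epsilon)\subseteq\mathcal{R}(\epsilon),$$ which also implies $\mathcal{T}(\epsilon)\subseteq\mathcal{T}(\bar\epsilon)$. Furthermore, for such $\epsilon$, $$\mathcal{T}_2(\bar\epsilon)\cap\big(\mathcal{N}(\epsilon)\cup\mathcal{T}_1(\epsilon)\cup\mathcal{T}_3(\epsilon)\big)=\emptyset,\qquad \mathcal{T}_3(\bar\epsilon)\cap\big(\mathcal{B}(\epsilon)\cup\mathcal{T}_1(\epsilon)\cup\mathcal{T}_2(\epsilon)\big)=\emptyset.$$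
   Context: Setting. Let $\mathbb{L}^{n_i}_+=\{x^i\in\mathbb{R}^{n_i}: x^i_1\ge\|x^i_{2:n_i}\|\}$ ($\|\cdot\|$ the $\ell_2$ norm), with interior $\mathrm{int}(\mathbb{L}^{n_i}_+)=\{x^i: x^i_1>\|x^i_{2:n_i}\|\}$ and boundary $\mathrm{bd}(\mathbb{L}^{n_i}_+)=\{x^i: x^i_1=\|x^i_{2:n_i}\|\}$. Let $\mathcal{L}^{\bar n}_+=\mathbb{L}^{n_1}_+\times\cdots\times\mathbb{L}^{n_p}_+$, $\bar n=\sum_{i=1}^p n_i$. Data: $A=(A^1,\ldots,A^p)\in\mathbb{R}^{m\times\bar n}$ with $A^i\in\mathbb{R}^{m\times n_i}$, $b\in\mathbb{R}^m$, $c,\bar c\in\mathbb{R}^{\bar n}$, $\bar c\ne0$ fixed. For $\epsilon\in\mathbb{R}$ consider $(\mathrm{P}_\epsilon)$: $\inf_x\{(c+\epsilon\bar c)^Tx: Ax=b,\ x\in\mathcal{L}^{\bar n}_+\}$ and $(\mathrm{D}_\epsilon)$: $\sup_{(y;s)}\{b^Ty: A^Ty+s=c+\epsilon\bar c,\ s\in\mathcal{L}^{\bar n}_+\}$, with vectors partitioned as $x=(x^1;\ldots;x^p)$, $s=(s^1;\ldots;s^p)$. Standing assumptions: $A$ has full row rank, and at $\epsilon=0$ there is a feasible $(x;y;s)$ of $(\mathrm{P}_0)$ and $(\mathrm{D}_0)$ with $x^i,s^i\in\mathrm{int}(\mathbb{L}^{n_i}_+)$ for all $i$. $\psi(\epsilon)\in\mathbb{R}\cup\{\pm\infty\}$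 is the optimal value of $(\mathrm{P}_\epsilon)$; $\mathcal{E}=\{\epsilon:\psi(\epsilon)\in\mathbb{R}\}$, which is a non-singleton closed interval. The optimal sets are $\mathcal{P}^*(\epsilon)=\{x\in\mathcal{L}^{\bar n}_+: Ax=b,\ (c+\epsilon\bar c)^Tx=\psi(\epsilon)\}$ and $\mathcal{D}^*(\epsilon)=\{(y;s): s\in\mathcal{L}^{\bar n}_+,\ A^Ty+s=c+\epsilon\bar c,\ b^Ty=\psi(\epsilon)\}$; they are nonempty and compact for $\epsilon\in\mathrm{int}(\mathcal{E})$. Optimal partition. $\mathcal{B}(\epsilon)=\{i:\exists x\in\mathcal{P}^*(\epsilon),\ x^i\in\mathrm{int}(\mathbb{L}^{n_i}_+)\}$; $\mathcal{N}(\epsilon)=\{i:\exists (y;s)\in\mathcal{D}^*(\epsilon),\ s^i\in\mathrm{int}(\mathbb{L}^{n_i}_+)\}$; $\mathcal{R}(\epsilon)=\{i:\exists (x;y;s)\in\mathcal{P}^*(\epsilon)\times\mathcal{D}^*(\epsilon),\ x^i,s^i\in\mathrm{bd}(\mathbb{L}^{n_i}_+)\setminus\{0\}\}$; $\mathcal{T}(\epsilon)=\{1,\ldots,p\}\setminus(\mathcal{B}(\epsilon)\cup\mathcal{N}(\epsilon)\cup\mathcal{R}(\epsilon))$. $\mathcal{T}(\epsilon)$ is further partitioned into $\mathcal{T}_1(\epsilon)=\{i\in\mathcal{T}(\epsilon): x^i=s^i=0\ \forall (x;y;s)\in\mathcal{P}^*(\epsilon)\times\mathcal{D}^*(\epsilon)\}$;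 $\mathcal{T}_2(\epsilon)=\{i\in\mathcal{T}(\epsilon):\exists x\in\mathcal{P}^*(\epsilon),\ x^i\in\mathrm{bd}(\mathbb{L}^{n_i}_+)\setminus\{0\}$, and $s^i=0\ \forall (y;s)\in\mathcal{D}^*(\epsilon)\}$; $\mathcal{T}_3(\epsilon)=\{i\in\mathcal{T}(\epsilon):\exists (y;s)\in\mathcal{D}^*(\epsilon),\ s^i\in\mathrm{bd}(\mathbb{L}^{n_i}_+)\setminus\{0\}$, and $x^i=0\ \forall x\in\mathcal{P}^*(\epsilon)\}$. Continuity (Painlevé–Kuratowski). A set-valued mapping $\Phi$ is continuous at $\bar\epsilon$ relative to $\Gamma\ni\bar\epsilon$ if it is outer semicontinuous ($x_k\in\Phi(\epsilon_k)$, $\epsilon_k\in\Gamma$, $\epsilon_k\to\bar\epsilon$, $x_k\to x$ imply $x\in\Phi(\bar\epsilon)$) and inner semicontinuous (for every $x\in\Phi(\bar\epsilon)$ and every sequence $\epsilon_k\in\Gamma$ with $\epsilon_k\to\bar\epsilon$ there exist $x_k\in\Phi(\epsilon_k)$ with $x_k\to x$). *)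

theory Defs
  imports "HOL-Analysis.Analysis"
begin

text \<open>
  Block-structured vectors: \<open>x = (x\<^sup>1; \<dots>; x\<^sup>p)\<close> is a vector of type \<open>real ^ 'n\<close>, where the
  coordinates are assigned to the blocks (the elements of the finite type \<open>'p\<close>) by
  \<open>blk :: 'n \<Rightarrow> 'p\<close>, and \<open>lead i\<close> is the first coordinate of block \<open>i\<close>;
  the record does not enforce \<open>blk (lead i) = i\<close>, which has to be assumed separately.  Thus \<open>p = CARD('p)\<close>,
  \<open>n\<^sub>i = card {j. blk j = i}\<close>, and every choice of \<open>p \<ge> 1\<close> and \<open>n\<^sub>i \<ge> 1\<close> arises in this way.
  The subvector \<open>x\<^sup>i\<close> is represented by padding it with zeros outside block \<open>i\<close>, which changes
  neither its norm nor its being zero.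
\<close>

record ('m::finite, 'n::finite, 'p::finite) socp =
  coeff_mat :: "real ^ 'n ^ 'm"
  rhs :: "real ^ 'm"
  cost :: "real ^ 'n"
  cost_dir :: "real ^ 'n"
  blk :: "'n \<Rightarrow> 'p"
  lead :: "'p \<Rightarrow> 'n"

definition block :: "('m::finite, 'n::finite, 'p::finite) socp \<Rightarrow> 'p \<Rightarrow> real ^ 'n \<Rightarrow> real ^ 'n" where
  "block Q i x = (\<chi> j. if blk Q j = i then x $ j else 0)"

definition tail :: "'n::finite \<Rightarrow> real ^ 'n \<Rightarrow> real ^ 'n" where
  "tail h v = (\<chi> j. if j = h then 0 else v $ j)"

text \<open>
  Second-order cone with axis \<open>h\<close>; applied to \<open>block Q i x\<close> with \<open>h = lead Q i\<close>, the defining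
  condition is the one for \<open>x\<^sup>i\<close> in dimension \<open>n\<^sub>i\<close>.
\<close>

definition soc :: "'n::finite \<Rightarrow> (real ^ 'n) set" where
  "soc h = {v. v $ h \<ge> norm (tail h v)}"

definition soc_int :: "'n::finite \<Rightarrow> (real ^ 'n) set" where
  "soc_int h = {v. v $ h > norm (tail h v)}"

definition soc_bd :: "'n::finite \<Rightarrow> (real ^ 'n) set" where
  "soc_bd h = {v. v $ h = norm (tail h v)}"

definition prod_cone :: "('m::finite, 'n::finite, 'p::finite) socp \<Rightarrow> (real ^ 'n) set" where
  "prod_cone Q = {x. \<forall>i. block Q i x \<in> soc (lead Q i)}"

definition cost_at :: "('m::finite, 'n::finite, 'p::finite) socp \<Rightarrow> real \<Rightarrow> real ^ 'n" where
  "cost_at Q \<epsilon> = cost Q + \<epsilon> *\<^sub>R cost_dir Q"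

definition primal_feasible :: "('m::finite, 'n::finite, 'p::finite) socp \<Rightarrow> (real ^ 'n) set" where
  "primal_feasible Q = {x. coeff_mat Q *v x = rhs Q \<and> x \<in> prod_cone Q}"

definition dual_feasible ::
    "('m::finite, 'n::finite, 'p::finite) socp \<Rightarrow> real \<Rightarrow> ((real ^ 'm) \<times> (real ^ 'n)) set" where
  "dual_feasible Q \<epsilon> =
     {(y, s). transpose (coeff_mat Q) *v y + s = cost_at Q \<epsilon> \<and> s \<in> prod_cone Q}"

definition opt_val :: "('m::finite, 'n::finite, 'p::finite) socp \<Rightarrow> real \<Rightarrow> ereal" where
  "opt_val Q \<epsilon> = (INF x\<in>primal_feasible Q. ereal (cost_at Q \<epsilon> \<bullet> x))"

definition finite_dom :: "('m::finite, 'n::finite, 'p::finite) socp \<Rightarrow> real set" where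
  "finite_dom Q = {\<epsilon>. \<bar>opt_val Q \<epsilon>\<bar> \<noteq> \<infinity>}"

definition primal_opt :: "('m::finite, 'n::finite, 'p::finite) socp \<Rightarrow> real \<Rightarrow> (real ^ 'n) set" where
  "primal_opt Q \<epsilon> = {x \<in> primal_feasible Q. ereal (cost_at Q \<epsilon> \<bullet> x) = opt_val Q \<epsilon>}"

text \<open>The value on the right is the optimal value of the primal problem, not of the dual.\<close>

definition dual_opt ::
    "('m::finite, 'n::finite, 'p::finite) socp \<Rightarrow> real \<Rightarrow> ((real ^ 'm) \<times> (real ^ 'n)) set" where
  "dual_opt Q \<epsilon> = {(y, s) \<in> dual_feasible Q \<epsilon>. ereal (rhs Q \<bullet> y) = opt_val Q \<epsilon>}"

definition part_B :: "('m::finite, 'n::finite, 'p::finite) socp \<Rightarrow> real \<Rightarrow> 'p set" where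
  "part_B Q \<epsilon> = {i. \<exists>x\<in>primal_opt Q \<epsilon>. block Q i x \<in> soc_int (lead Q i)}"

definition part_N :: "('m::finite, 'n::finite, 'p::finite) socp \<Rightarrow> real \<Rightarrow> 'p set" where
  "part_N Q \<epsilon> = {i. \<exists>(y, s)\<in>dual_opt Q \<epsilon>. block Q i s \<in> soc_int (lead Q i)}"

definition part_R :: "('m::finite, 'n::finite, 'p::finite) socp \<Rightarrow> real \<Rightarrow> 'p set" where
  "part_R Q \<epsilon> = {i. \<exists>x\<in>primal_opt Q \<epsilon>. \<exists>(y, s)\<in>dual_opt Q \<epsilon>.
     block Q i x \<in> soc_bd (lead Q i) - {0} \<and> block Q i s \<in> soc_bd (lead Q i) - {0}}"

definition part_T :: "('m::finite, 'n::finite, 'p::finite) socp \<Rightarrow> real \<Rightarrow> 'p set" where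
  "part_T Q \<epsilon> = UNIV - (part_B Q \<epsilon> \<union> part_N Q \<epsilon> \<union> part_R Q \<epsilon>)"

definition part_T1 :: "('m::finite, 'n::finite, 'p::finite) socp \<Rightarrow> real \<Rightarrow> 'p set" where
  "part_T1 Q \<epsilon> = {i \<in> part_T Q \<epsilon>.
     \<forall>x\<in>primal_opt Q \<epsilon>. \<forall>(y, s)\<in>dual_opt Q \<epsilon>. block Q i x = 0 \<and> block Q i s = 0}"

definition part_T2 :: "('m::finite, 'n::finite, 'p::finite) socp \<Rightarrow> real \<Rightarrow> 'p set" where
  "part_T2 Q \<epsilon> = {i \<in> part_T Q \<epsilon>.
     (\<exists>x\<in>primal_opt Q \<epsilon>. block Q i x \<in> soc_bd (lead Q i) - {0}) \<and>
     (\<forall>(y, s)\<in>dual_opt Q \<epsilon>. block Q i s = 0)}"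

definition part_T3 :: "('m::finite, 'n::finite, 'p::finite) socp \<Rightarrow> real \<Rightarrow> 'p set" where
  "part_T3 Q \<epsilon> = {i \<in> part_T Q \<epsilon>.
     (\<exists>(y, s)\<in>dual_opt Q \<epsilon>. block Q i s \<in> soc_bd (lead Q i) - {0}) \<and>
     (\<forall>x\<in>primal_opt Q \<epsilon>. block Q i x = 0)}"

definition outer_semicont_at ::
    "(real \<Rightarrow> 'a::topological_space set) \<Rightarrow> real set \<Rightarrow> real \<Rightarrow> bool" where
  "outer_semicont_at \<Phi> \<Gamma> a \<longleftrightarrow>
     (\<forall>e x l. (\<forall>k::nat. e k \<in> \<Gamma> \<and> x k \<in> \<Phi> (e k)) \<and> e \<longlonglongrightarrow> a \<and> x \<longlonglongrightarrow> l \<longrightarrow> l \<in> \<Phi> a)"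

definition inner_semicont_at ::
    "(real \<Rightarrow> 'a::topological_space set) \<Rightarrow> real set \<Rightarrow> real \<Rightarrow> bool" where
  "inner_semicont_at \<Phi> \<Gamma> a \<longleftrightarrow>
     (\<forall>l\<in>\<Phi> a. \<forall>e. (\<forall>k::nat. e k \<in> \<Gamma>) \<and> e \<longlonglongrightarrow> a \<longrightarrow>
        (\<exists>x. (\<forall>k. x k \<in> \<Phi> (e k)) \<and> x \<longlonglongrightarrow> l))"

text \<open>Painleve--Kuratowski continuity at a point of \<open>\<Gamma>\<close>, relative to \<open>\<Gamma>\<close>.\<close>

definition pk_continuous_at ::
    "(real \<Rightarrow> 'a::topological_space set) \<Rightarrow> real set \<Rightarrow> real \<Rightarrow> bool" where
  "pk_continuous_at \<Phi> \<Gamma> a \<longleftrightarrow>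
     a \<in> \<Gamma> \<and> outer_semicont_at \<Phi> \<Gamma> a \<and> inner_semicont_at \<Phi> \<Gamma> a"

end

theory Submission
  imports Defs
begin

text \<open>
  Membership of a block \<open>i\<close> in \<open>\<B>\<close>, \<open>\<N>\<close> or \<open>\<R>\<close> comes down to the existence of optimal solutions in open
  sets.  For \<open>\<B>\<close> and \<open>\<N>\<close> this is immediate, since the interior of the cone is open.  For \<open>\<R>\<close> it
  rests on complementarity: optimal \<open>x\<close> and \<open>s\<close> satisfy \<open>x\<^sup>i \<bullet> s\<^sup>i = 0\<close> in every block, and an interior
  point of the second-order cone has positive inner product with every nonzero point of the cone,
  so \<open>x\<^sup>i \<noteq> 0 \<noteq> s\<^sup>i\<close> already forces both onto the boundary (\<open>complementary_blocks\<close>).  Thus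
  \<open>i \<in> \<R>\<close> as soon as some optimal \<open>x\<close> has \<open>x\<^sup>i \<noteq> 0\<close> and some optimal \<open>s\<close> has \<open>s\<^sup>i \<noteq> 0\<close>, and these
  conditions are open too.  Inner semicontinuity says precisely that an open set meeting the optimal
  set at \<open>\<epsilon>\<^sub>0\<close> meets the optimal sets at all nearby \<open>\<epsilon>\<close> (\<open>inner_semicont_at_eventually_meets\<close>).
  The finitely many blocks then share one neighbourhood.

  For \<open>i \<in> \<T>\<^sub>2(\<epsilon>\<^sub>0)\<close> some optimal \<open>x\<close> has \<open>x\<^sup>i \<noteq> 0\<close>, hence so does some optimal \<open>x\<close> at every nearby \<open>\<epsilon>\<close>.
  By complementarity this excludes an interior \<open>s\<^sup>i\<close>, so \<open>i \<notin> \<N>(\<epsilon>)\<close>; and it contradicts \<open>x\<^sup>i = 0\<close>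
  in the definition of \<open>\<T>\<^sub>3(\<epsilon>)\<close>.  It contradicts the definition of \<open>\<T>\<^sub>1(\<epsilon>)\<close> as well, but there
  \<open>x\<^sup>i = 0\<close> is asserted for pairs of optimal solutions, which is void if there is no dual optimal
  solution.  The case of \<open>\<T>\<^sub>3(\<epsilon>\<^sub>0)\<close> is symmetric and needs a primal optimal solution.

  Attainment of both optima on the interior of the domain of the value function is therefore
  needed, and this is where strict feasibility and full row rank enter.  The dual optimum is attained
  with zero duality gap by separation (\<open>conic_duality\<close>) and self-duality of the cone.  For the primal
  optimum, feasibility of the dual slightly further away from \<open>0\<close> is averaged with strict
  feasibility at \<open>0\<close>, which gives strict dual feasibility at \<open>\<epsilon>\<close> (\<open>dual_interior_feasible\<close>); this
  makes primal sublevel sets compact.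
\<close>

section \<open>The second-order cone\<close>

lemma tail_eq: "tail h v = v - axis h (v $ h)"
  by (auto simp: tail_def vec_eq_iff axis_def)

lemma linear_tail: "linear (tail h)"
  by (rule linearI) (auto simp: tail_def vec_eq_iff)

lemma inner_head_tail: "v \<bullet> w = v $ h * w $ h + tail h v \<bullet> tail h w"
proof -
  have "v \<bullet> w = v $ h * w $ h + (\<Sum>j\<in>UNIV - {h}. v $ j * w $ j)"
    by (simp add: inner_vec_def sum.remove[of UNIV h])
  also have "(\<Sum>j\<in>UNIV - {h}. v $ j * w $ j) = tail h v \<bullet> tail h w"
    by (simp add: inner_vec_def tail_def sum.remove[of UNIV h])
  finally show ?thesis .
qed

lemma zero_in_soc: "0 \<in> soc h"
  by (simp add: soc_def linear_0[OF linear_tail])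

lemma scaleR_in_soc: "v \<in> soc h \<Longrightarrow> 0 \<le> a \<Longrightarrow> a *\<^sub>R v \<in> soc h"
  by (simp add: soc_def linear_cmul[OF linear_tail] mult_left_mono)

lemma add_in_soc: "v \<in> soc h \<Longrightarrow> w \<in> soc h \<Longrightarrow> v + w \<in> soc h"
  by (simp add: soc_def linear_add[OF linear_tail])
     (smt (verit) norm_triangle_ineq)

lemma soc_int_subset_soc: "soc_int h \<subseteq> soc h"
  by (auto simp: soc_int_def soc_def)

lemma soc_int_or_bd: "v \<in> soc h \<Longrightarrow> v \<notin> soc_int h \<Longrightarrow> v \<in> soc_bd h"
  by (auto simp: soc_int_def soc_def soc_bd_def)

lemma soc_int_nonzero: "v \<in> soc_int h \<Longrightarrow> v \<noteq> 0"
  by (auto simp: soc_int_def)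

lemma soc_int_bd_disjoint: "v \<in> soc_bd h \<Longrightarrow> v \<notin> soc_int h"
  by (simp add: soc_int_def soc_bd_def)

lemma continuous_on_tail: "continuous_on A (tail h)"
  using linear_continuous_on linear_conv_bounded_linear linear_tail by blast

lemma open_soc_int: "open (soc_int h)"
  unfolding soc_int_def
  by (intro open_Collect_less continuous_intros continuous_on_tail)

lemma closed_soc: "closed (soc h)"
  unfolding soc_def
  by (intro closed_Collect_le continuous_intros continuous_on_tail)

text \<open>
  By Cauchy--Schwarz the tails contribute at least \<open>- \<parallel>tail v\<parallel> \<parallel>tail w\<parallel> \<ge> - \<parallel>tail v\<parallel> w\<^sub>h\<close>.  Both the
  nonnegativity and the strict positivity of inner products on the cone are read off this bound.
\<close>

lemma inner_soc_ge:
  assumes "w \<in> soc h"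
  shows "(v $ h - norm (tail h v)) * w $ h \<le> v \<bullet> w"
proof -
  have "- (norm (tail h v) * w $ h) \<le> - (norm (tail h v) * norm (tail h w))"
    using assms by (simp add: soc_def mult_left_mono)
  also have "\<dots> \<le> tail h v \<bullet> tail h w"
    using Cauchy_Schwarz_ineq2[of "tail h v" "tail h w"] by linarith
  finally show ?thesis
    by (simp add: inner_head_tail[of v w h] algebra_simps)
qed

lemma soc_head_nonneg: "w \<in> soc h \<Longrightarrow> 0 \<le> w $ h"
  unfolding soc_def using norm_ge_zero order_trans by blast

lemma soc_head_pos:
  assumes "w \<in> soc h" "w \<noteq> 0"
  shows "0 < w $ h"
proof (rule ccontr)
  assume "\<not> 0 < w $ h"
  with soc_head_nonneg[OF assms(1)] have "w $ h = 0" by simp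
  with assms(1) have "tail h w = 0" by (simp add: soc_def)
  with \<open>w $ h = 0\<close> show False using assms(2) by (simp add: tail_eq)
qed

lemma inner_soc_nonneg:
  assumes "v \<in> soc h" "w \<in> soc h"
  shows "0 \<le> v \<bullet> w"
proof -
  have "0 \<le> (v $ h - norm (tail h v)) * w $ h"
    using assms soc_head_nonneg[OF assms(2)] by (simp add: soc_def)
  with inner_soc_ge[OF assms(2), of v] show ?thesis by linarith
qed

lemma inner_soc_int_pos:
  assumes "v \<in> soc_int h" "w \<in> soc h" "w \<noteq> 0"
  shows "0 < v \<bullet> w"
proof -
  have "0 < (v $ h - norm (tail h v)) * w $ h"
    using assms(1) soc_head_pos[OF assms(2,3)] by (simp add: soc_int_def)
  with inner_soc_ge[OF assms(2), of v] show ?thesis by linarith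
qed

text \<open>
  It suffices to test \<open>s\<close> against vectors \<open>(a; - tail s)\<close> with \<open>a \<ge> \<parallel>tail s\<parallel>\<close>, which give
  \<open>\<parallel>tail s\<parallel>\<^sup>2 \<le> s\<^sub>h a\<close>.  The choice \<open>a = \<parallel>tail s\<parallel>\<close> settles the matter unless \<open>tail s = 0\<close>,
  where it says nothing and \<open>a = 1\<close> is taken instead.
\<close>

lemma soc_self_dual:
  assumes "\<And>x. x \<in> soc h \<Longrightarrow> 0 \<le> s \<bullet> x"
  shows "s \<in> soc h"
proof -
  define t where "t = tail h s"
  have test: "norm t * norm t \<le> s $ h * a" if "norm t \<le> a" for a
  proof -
    define x where "x = axis h a - t"
    have x: "x $ h = a" "tail h x = - t"
      by (auto simp: x_def t_def tail_def axis_def vec_eq_iff)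
    have "0 \<le> s \<bullet> x"
      using that by (intro assms) (simp add: soc_def x)
    also have "s \<bullet> x = s $ h * a - t \<bullet> t"
      by (simp add: inner_head_tail[of s x h] x flip: t_def)
    finally show ?thesis
      by (simp add: power2_norm_eq_inner[symmetric] power2_eq_square)
  qed
  have "norm t \<le> s $ h"
  proof (cases "t = 0")
    case True
    then show ?thesis using test[of 1] by simp
  next
    case False
    then show ?thesis using test[of "norm t"] by simp
  qed
  then show ?thesis by (simp add: soc_def t_def)
qed

section \<open>The product cone\<close>

lemma linear_block: "linear (block Q i)"
  by (rule linearI) (auto simp: block_def vec_eq_iff)

lemma continuous_on_block: "continuous_on A (block Q i)"
  using linear_continuous_on linear_conv_bounded_linear linear_block by blast

lemma open_block_nonzero: "open {x. block Q i x \<noteq> 0}"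
  by (intro open_Collect_neq continuous_intros continuous_on_block)

lemma open_block_soc_int: "open {x. block Q i x \<in> soc_int (lead Q i)}"
  using open_vimage[OF open_soc_int continuous_on_block] by (simp add: vimage_def)

lemma block_block: "block Q j (block Q i x) = (if j = i then block Q i x else 0)"
  by (auto simp: block_def vec_eq_iff)

lemma inner_block_swap: "s \<bullet> block Q i x = block Q i s \<bullet> x"
  by (auto simp: block_def inner_vec_def intro!: sum.cong)

lemma inner_eq_sum_blocks: "x \<bullet> s = (\<Sum>i\<in>UNIV. block Q i x \<bullet> block Q i s)"
proof -
  have "(\<Sum>i\<in>UNIV. block Q i x) = x"
    by (simp add: vec_eq_iff block_def)
  then have "x \<bullet> s = (\<Sum>i\<in>UNIV. block Q i x \<bullet> s)"
    by (metis inner_sum_left)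
  also have "\<dots> = (\<Sum>i\<in>UNIV. block Q i x \<bullet> block Q i s)"
    by (simp add: inner_block_swap block_block)
  finally show ?thesis .
qed

text \<open>
  A block inherits membership in the cone on the whole space because deleting coordinates other
  than the axis only shortens the tail.  This lets self-duality of the product cone be deduced
  from \<open>soc_self_dual\<close> on the whole space, block by block.
\<close>

lemma block_in_soc:
  assumes "blk Q h = i" "x \<in> soc h"
  shows "block Q i x \<in> soc h"
proof -
  have "norm (tail h (block Q i x)) \<le> norm (tail h x)"
    by (rule norm_le_componentwise_cart) (simp add: tail_def block_def)
  then show ?thesis using assms by (simp add: soc_def block_def)
qed

lemma prod_coneD: "x \<in> prod_cone Q \<Longrightarrow> block Q i x \<in> soc (lead Q i)"
  by (simp add: prod_cone_def)

lemma scaleR_in_prod_cone: "x \<in> prod_cone Q \<Longrightarrow> 0 \<le> a \<Longrightarrow> a *\<^sub>R x \<in> prod_cone Q"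
  by (simp add: prod_cone_def linear_cmul[OF linear_block] scaleR_in_soc)

lemma convex_prod_cone: "convex (prod_cone Q)"
  by (rule convexI)
     (simp add: prod_cone_def linear_add[OF linear_block] linear_cmul[OF linear_block]
       add_in_soc scaleR_in_soc)

lemma closed_prod_cone: "closed (prod_cone Q)"
proof -
  have "prod_cone Q = (\<Inter>i. block Q i -` soc (lead Q i))"
    by (auto simp: prod_cone_def)
  then show ?thesis
    by (auto intro!: closed_INT closed_vimage closed_soc continuous_on_block)
qed

lemma interior_prod_coneI:
  assumes "\<And>i. block Q i x \<in> soc_int (lead Q i)"
  shows "x \<in> interior (prod_cone Q)"
proof (rule interiorI)
  show "open (\<Inter>i. block Q i -` soc_int (lead Q i))"
    by (auto intro!: open_INT open_vimage open_soc_int continuous_on_block)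
  show "x \<in> (\<Inter>i. block Q i -` soc_int (lead Q i))"
    using assms by simp
  show "(\<Inter>i. block Q i -` soc_int (lead Q i)) \<subseteq> prod_cone Q"
    using soc_int_subset_soc by (auto simp: prod_cone_def)
qed

lemma inner_prod_cone_nonneg:
  "x \<in> prod_cone Q \<Longrightarrow> s \<in> prod_cone Q \<Longrightarrow> 0 \<le> x \<bullet> s"
  unfolding inner_eq_sum_blocks[of x s Q]
  by (intro sum_nonneg inner_soc_nonneg[OF prod_coneD prod_coneD])

lemma prod_cone_self_dual:
  assumes lead: "\<And>i. blk Q (lead Q i) = i"
    and dual: "\<And>x. x \<in> prod_cone Q \<Longrightarrow> 0 \<le> s \<bullet> x"
  shows "s \<in> prod_cone Q"
proof -
  have "block Q i s \<in> soc (lead Q i)" for i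
  proof (rule soc_self_dual)
    fix x assume "x \<in> soc (lead Q i)"
    then have "block Q i x \<in> prod_cone Q"
      by (simp add: prod_cone_def block_block block_in_soc lead zero_in_soc)
    then show "0 \<le> block Q i s \<bullet> x"
      using dual by (simp flip: inner_block_swap)
  qed
  then show ?thesis by (simp add: prod_cone_def)
qed

text \<open>
  A ball of radius \<open>r\<close> around \<open>s\<close> contains \<open>s - r x / \<parallel>x\<parallel>\<close>, which then still has nonnegative inner
  product with \<open>x\<close>.  This is what bounds the sublevel sets of the primal problem.
\<close>

lemma interior_prod_cone_coercive:
  assumes "s \<in> interior (prod_cone Q)"
  obtains r where "0 < r" "\<And>x. x \<in> prod_cone Q \<Longrightarrow> r * norm x \<le> s \<bullet> x"
proof -
  obtain r where r: "0 < r" "cball s r \<subseteq> prod_cone Q"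
    using assms mem_interior_cball by blast
  have "r * norm x \<le> s \<bullet> x" if x: "x \<in> prod_cone Q" for x
  proof -
    have "s - r *\<^sub>R sgn x \<in> prod_cone Q"
      using r by (intro subsetD[OF r(2)]) (simp add: dist_norm norm_sgn)
    then have "0 \<le> (s - r *\<^sub>R sgn x) \<bullet> x"
      using inner_prod_cone_nonneg x by blast
    moreover have "sgn x \<bullet> x = norm x"
      by (cases "x = 0")
         (simp_all add: sgn_div_norm power2_norm_eq_inner[symmetric] power2_eq_square field_simps)
    ultimately show ?thesis by (simp add: inner_diff_left)
  qed
  with r(1) that show ?thesis by blast
qed

section \<open>Duality\<close>

lemma exists_small_multiple:
  fixes a e :: real
  assumes "0 < e" "0 \<le> a"
  obtains t where "0 < t" "t * a < e"
proof
  have "0 < a + 1" using assms(2) by simp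
  then show t: "0 < e / (a + 1)" using assms(1) by simp
  have "e / (a + 1) * a = e - e / (a + 1)" using \<open>0 < a + 1\<close> by (simp add: field_simps)
  with t show "e / (a + 1) * a < e" by simp
qed

text \<open>
  If \<open>v\<close> is a lower bound of the primal problem, the convex set of all \<open>(A x - b, c \<bullet> x + r - v)\<close>
  with \<open>x \<in> K\<close> and \<open>r > 0\<close> avoids the origin.  A separating functional \<open>(w, \<tau>)\<close> has \<open>\<tau> \<ge> 0\<close>.  If
  \<open>\<tau> = 0\<close>, the linear form \<open>A\<^sup>T w\<close> would attain its minimum over \<open>K\<close> at the interior point \<open>x\<^sub>0\<close>, so
  it would vanish, against injectivity of \<open>A\<^sup>T\<close>.  Hence \<open>\<tau> > 0\<close> and \<open>y = - w / \<tau>\<close> is the desired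
  dual solution.
\<close>

lemma conic_duality:
  fixes A :: "real ^ 'n ^ 'm" and K :: "(real ^ 'n) set"
  assumes K: "convex K" "0 \<in> K" "\<And>x a. x \<in> K \<Longrightarrow> 0 \<le> a \<Longrightarrow> a *\<^sub>R x \<in> K"
    and slater: "x\<^sub>0 \<in> interior K" "A *v x\<^sub>0 = b"
    and inj: "inj ((*v) (transpose A))"
    and bound: "\<And>x. x \<in> K \<Longrightarrow> A *v x = b \<Longrightarrow> v \<le> c \<bullet> x"
  obtains y where "\<And>x. x \<in> K \<Longrightarrow> 0 \<le> (c - transpose A *v y) \<bullet> x" "v \<le> b \<bullet> y"
proof -
  define f where "f = (\<lambda>(x, r). (A *v x, c \<bullet> x + r :: real))"
  define M where "M = (+) (- b, - v) ` f ` (K \<times> {0<..})"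
  have "linear f"
    by (rule linearI)
       (auto simp: f_def inner_add_right matrix_vector_right_distrib matrix_vector_mult_scaleR algebra_simps)
  then have "convex M"
    unfolding M_def using K(1)
    by (intro convex_translation convex_linear_image convex_Times) auto
  moreover have "0 \<notin> M"
    using bound by (force simp: M_def f_def zero_prod_def)
  ultimately obtain p where p: "p \<noteq> 0" "\<And>z. z \<in> M \<Longrightarrow> 0 \<le> p \<bullet> z"
    using separating_hyperplane_set_0 by blast
  obtain w \<tau> where w: "p = (w, \<tau>)" by (cases p)
  have sep: "0 \<le> w \<bullet> (A *v x - b) + \<tau> * (c \<bullet> x + r - v)" if "x \<in> K" "0 < r" for x r
  proof -
    have "(A *v x - b, c \<bullet> x + r - v) \<in> M"
      using that by (force simp: M_def f_def)
    then show ?thesis using p(2) w by fastforce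
  qed
  have x0: "x\<^sub>0 \<in> K" using slater interior_subset by blast
  have "v \<le> c \<bullet> x\<^sub>0" using bound x0 slater by blast
  then have "0 \<le> \<tau>"
    using sep[OF x0, of 1] slater by (simp add: zero_le_mult_iff)
  have "\<tau> \<noteq> 0"
  proof
    assume "\<tau> = 0"
    define d where "d = transpose A *v w"
    have d: "d \<bullet> z = w \<bullet> (A *v z)" for z
      by (simp add: d_def dot_lmul_matrix)
    \<comment> \<open>A small step from \<open>x\<^sub>0\<close> along \<open>- d\<close> stays in \<open>K\<close> and makes the functional negative.\<close>
    obtain e where e: "0 < e" "ball x\<^sub>0 e \<subseteq> K"
      using slater mem_interior by blast
    obtain t where t: "0 < t" "t * norm d < e"
      using exists_small_multiple[OF e(1) norm_ge_zero] .
    then have "x\<^sub>0 - t *\<^sub>R d \<in> K"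
      by (intro subsetD[OF e(2)]) (simp add: dist_norm)
    from sep[OF this, of 1] have "0 \<le> d \<bullet> (x\<^sub>0 - t *\<^sub>R d) - w \<bullet> b"
      using d[of "x\<^sub>0 - t *\<^sub>R d"] by (simp add: \<open>\<tau> = 0\<close> inner_diff_right)
    also have "\<dots> = - t * (d \<bullet> d)"
      using slater d[of x\<^sub>0] by (simp add: inner_diff_right)
    finally have "d \<bullet> d \<le> 0"
      using t(1) by (simp add: mult_le_0_iff)
    then have "d = 0"
      by (metis inner_eq_zero_iff inner_ge_zero order_antisym)
    then have "w = 0"
      using inj by (metis d_def injD matrix_vector_mult_0_right)
    then show False using p(1) w \<open>\<tau> = 0\<close> by (simp add: zero_prod_def)
  qed
  with \<open>0 \<le> \<tau>\<close> have "0 < \<tau>" by simp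
  define y where "y = - (1 / \<tau>) *\<^sub>R w"
  have wy: "w = - \<tau> *\<^sub>R y" using \<open>0 < \<tau>\<close> by (simp add: y_def)
  have main: "v - b \<bullet> y \<le> (c - transpose A *v y) \<bullet> x" if "x \<in> K" for x
  proof (rule field_le_epsilon)
    fix r :: real assume "0 < r"
    from sep[OF that this]
    have "0 \<le> \<tau> * (c \<bullet> x + r - v - y \<bullet> (A *v x - b))"
      by (simp add: wy algebra_simps)
    then have "0 \<le> c \<bullet> x + r - v - y \<bullet> (A *v x - b)"
      using \<open>0 < \<tau>\<close> by (simp add: zero_le_mult_iff)
    then show "v - b \<bullet> y \<le> (c - transpose A *v y) \<bullet> x + r"
      by (simp add: inner_diff_left inner_diff_right dot_lmul_matrix inner_commute[of b])
  qed
  \<comment> \<open>The bound \<open>main\<close> at \<open>0\<close> compares the values; along a ray of \<open>K\<close> it excludes negative inner products.\<close>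
  show ?thesis
  proof (rule that)
    show "v \<le> b \<bullet> y" using main[OF K(2)] by simp
    fix x assume x: "x \<in> K"
    show "0 \<le> (c - transpose A *v y) \<bullet> x"
    proof (rule ccontr)
      define q where "q = (c - transpose A *v y) \<bullet> x"
      assume "\<not> 0 \<le> (c - transpose A *v y) \<bullet> x"
      then have q: "q < 0" by (simp add: q_def)
      define a where "a = (\<bar>v - b \<bullet> y\<bar> + 1) / - q"
      have "0 \<le> a" using q by (simp add: a_def divide_nonneg_neg)
      from main[OF K(3)[OF x this]] have "v - b \<bullet> y \<le> a * q"
        by (simp add: q_def)
      also have "\<dots> = - (\<bar>v - b \<bullet> y\<bar> + 1)" using q by (simp add: a_def)
      finally show False by linarith
    qed
  qed
qed

text \<open>
  On the primal feasible set \<open>s \<bullet> x\<close> differs from the objective by a constant, for each dual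
  feasible \<open>(y, s)\<close>.  Weak duality, the attainment of the primal optimum and complementarity all
  come from this identity.
\<close>

lemma feasible_gap:
  assumes "x \<in> primal_feasible Q" "(y, s) \<in> dual_feasible Q \<epsilon>"
  shows "cost_at Q \<epsilon> \<bullet> x = rhs Q \<bullet> y + s \<bullet> x"
proof -
  have "cost_at Q \<epsilon> \<bullet> x = (transpose (coeff_mat Q) *v y) \<bullet> x + s \<bullet> x"
    using assms(2) by (auto simp: dual_feasible_def simp flip: inner_add_left)
  also have "(transpose (coeff_mat Q) *v y) \<bullet> x = rhs Q \<bullet> y"
    using assms(1)
    by (simp add: primal_feasible_def dot_lmul_matrix inner_commute[of "rhs Q"])
  finally show ?thesis .
qed

lemma weak_duality:
  assumes "(y, s) \<in> dual_feasible Q \<epsilon>"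
  shows "ereal (rhs Q \<bullet> y) \<le> opt_val Q \<epsilon>"
  unfolding opt_val_def
proof (rule INF_greatest)
  fix x assume x: "x \<in> primal_feasible Q"
  have "0 \<le> s \<bullet> x"
    using x assms by (auto simp: primal_feasible_def dual_feasible_def intro: inner_prod_cone_nonneg)
  then show "ereal (rhs Q \<bullet> y) \<le> ereal (cost_at Q \<epsilon> \<bullet> x)"
    by (simp add: feasible_gap[OF x assms])
qed

lemma opt_val_le: "x \<in> primal_feasible Q \<Longrightarrow> opt_val Q \<epsilon> \<le> ereal (cost_at Q \<epsilon> \<bullet> x)"
  unfolding opt_val_def by (rule INF_lower)

text \<open>
  Primal feasibility does not involve \<open>\<epsilon>\<close>, so one interior feasible point \<open>x\<^sub>0\<close> makes
  \<open>conic_duality\<close> applicable at every \<open>\<epsilon>\<close> with finite optimal value.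
\<close>

lemma dual_opt_nonempty:
  fixes Q :: "('m::finite, 'n::finite, 'p::finite) socp"
  assumes lead: "\<And>i. blk Q (lead Q i) = i"
    and rank: "rank (coeff_mat Q) = CARD('m)"
    and x0: "x\<^sub>0 \<in> primal_feasible Q" "x\<^sub>0 \<in> interior (prod_cone Q)"
    and fin: "\<epsilon> \<in> finite_dom Q"
  shows "dual_opt Q \<epsilon> \<noteq> {}"
proof -
  obtain v where v: "opt_val Q \<epsilon> = ereal v"
    using fin by (cases "opt_val Q \<epsilon>") (auto simp: finite_dom_def)
  have "inj ((*v) (transpose (coeff_mat Q)))"
    using rank by (metis full_rank_injective rank_transpose)
  moreover have "coeff_mat Q *v x\<^sub>0 = rhs Q"
    using x0 by (simp add: primal_feasible_def)
  moreover have "v \<le> cost_at Q \<epsilon> \<bullet> x" if "x \<in> prod_cone Q" "coeff_mat Q *v x = rhs Q" for x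
    using opt_val_le[of x Q \<epsilon>] that v by (simp add: primal_feasible_def)
  moreover have "0 \<in> prod_cone Q"
    by (simp add: prod_cone_def linear_0[OF linear_block] zero_in_soc)
  ultimately obtain y where
    y: "\<And>x. x \<in> prod_cone Q \<Longrightarrow> 0 \<le> (cost_at Q \<epsilon> - transpose (coeff_mat Q) *v y) \<bullet> x"
      "v \<le> rhs Q \<bullet> y"
    using conic_duality[of "prod_cone Q" x\<^sub>0 "coeff_mat Q" "rhs Q" v "cost_at Q \<epsilon>"]
      convex_prod_cone scaleR_in_prod_cone x0(2) by metis
  define s where "s = cost_at Q \<epsilon> - transpose (coeff_mat Q) *v y"
  have feas: "(y, s) \<in> dual_feasible Q \<epsilon>"
    using prod_cone_self_dual[of Q s] lead y(1) by (simp add: dual_feasible_def s_def)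
  with weak_duality[OF this] y(2) v have "(y, s) \<in> dual_opt Q \<epsilon>"
    by (simp add: dual_opt_def)
  then show ?thesis by blast
qed

text \<open>
  By \<open>feasible_gap\<close>, the primal problem amounts to minimising \<open>s \<bullet> x\<close>, which is coercive on the
  cone since \<open>s\<close> is interior.
\<close>

lemma primal_opt_nonempty_if_dual_interior:
  assumes feas: "primal_feasible Q \<noteq> {}"
    and dual: "(y, s) \<in> dual_feasible Q \<epsilon>" "s \<in> interior (prod_cone Q)"
  shows "primal_opt Q \<epsilon> \<noteq> {}"
proof -
  obtain x\<^sub>0 where x0: "x\<^sub>0 \<in> primal_feasible Q" using feas by blast
  obtain r where r: "0 < r" "\<And>x. x \<in> prod_cone Q \<Longrightarrow> r * norm x \<le> s \<bullet> x"
    using interior_prod_cone_coercive[OF dual(2)] by blast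
  define C where "C = primal_feasible Q \<inter> {x. s \<bullet> x \<le> s \<bullet> x\<^sub>0}"
  have "primal_feasible Q = {x. coeff_mat Q *v x = rhs Q} \<inter> prod_cone Q"
    by (auto simp: primal_feasible_def)
  then have "closed C"
    unfolding C_def using closed_prod_cone
    by (auto intro!: closed_Int closed_Collect_le closed_Collect_eq continuous_intros
        linear_continuous_on simp: matrix_vector_mul_bounded_linear bounded_linear_inner_right)
  moreover have "norm x \<le> (s \<bullet> x\<^sub>0) / r" if "x \<in> C" for x
  proof -
    have "r * norm x \<le> s \<bullet> x\<^sub>0"
      using r(2)[of x] that by (auto simp: C_def primal_feasible_def)
    then show ?thesis using r(1) by (simp add: field_simps)
  qed
  then have "bounded C" by (auto simp: bounded_iff)
  ultimately have "compact C" by (simp add: compact_eq_bounded_closed)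
  moreover have "x\<^sub>0 \<in> C" using x0 by (simp add: C_def)
  ultimately obtain x where x: "x \<in> C" "\<And>z. z \<in> C \<Longrightarrow> s \<bullet> x \<le> s \<bullet> z"
    using continuous_attains_inf[of C "\<lambda>x. s \<bullet> x"] continuous_on_inner[OF continuous_on_const continuous_on_id] by blast
  have xf: "x \<in> primal_feasible Q" using x(1) by (simp add: C_def)
  have "s \<bullet> x \<le> s \<bullet> z" if "z \<in> primal_feasible Q" for z
    using x that by (cases "z \<in> C") (auto simp: C_def)
  then have "ereal (cost_at Q \<epsilon> \<bullet> x) \<le> opt_val Q \<epsilon>"
    unfolding opt_val_def
    by (intro INF_greatest) (simp add: feasible_gap[OF _ dual(1)] xf)
  with opt_val_le[OF xf] xf have "x \<in> primal_opt Q \<epsilon>"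
    by (simp add: primal_opt_def antisym)
  then show ?thesis by blast
qed

text \<open>
  The parameter \<open>\<epsilon>\<close> is a convex combination of \<open>0\<close> and \<open>(1 + t) \<epsilon>\<close>, which lies in \<open>E\<close> for small
  \<open>t > 0\<close>.  The same combination of a strictly feasible point at \<open>0\<close> and any feasible point at
  \<open>(1 + t) \<epsilon>\<close> is strictly feasible at \<open>\<epsilon>\<close>.
\<close>

lemma dual_interior_feasible:
  assumes dual: "\<And>\<epsilon>. \<epsilon> \<in> E \<Longrightarrow> dual_feasible Q \<epsilon> \<noteq> {}"
    and slater: "(y\<^sub>0, s\<^sub>0) \<in> dual_feasible Q 0" "s\<^sub>0 \<in> interior (prod_cone Q)"
    and eps: "\<epsilon> \<in> interior E"
  obtains y s where "(y, s) \<in> dual_feasible Q \<epsilon>" "s \<in> interior (prod_cone Q)"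
proof -
  obtain e where e: "0 < e" "ball \<epsilon> e \<subseteq> E"
    using eps mem_interior by blast
  obtain t where t: "0 < t" "t * \<bar>\<epsilon>\<bar> < e"
    using exists_small_multiple[OF e(1) abs_ge_zero] .
  have "dist \<epsilon> ((1 + t) * \<epsilon>) = t * \<bar>\<epsilon>\<bar>"
    using t(1) by (simp add: dist_real_def algebra_simps abs_mult)
  then have "(1 + t) * \<epsilon> \<in> E"
    using t e by (intro subsetD[OF e(2)]) simp
  from dual[OF this] obtain y\<^sub>1 s\<^sub>1
    where d1: "transpose (coeff_mat Q) *v y\<^sub>1 + s\<^sub>1 = cost_at Q ((1 + t) * \<epsilon>)" "s\<^sub>1 \<in> prod_cone Q"
    by (auto simp: dual_feasible_def)
  have d0: "transpose (coeff_mat Q) *v y\<^sub>0 + s\<^sub>0 = cost_at Q 0"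
    using slater(1) by (simp add: dual_feasible_def)
  define \<theta> where "\<theta> = t / (1 + t)"
  have \<theta>: "0 < \<theta>" "\<theta> \<le> 1" "(1 - \<theta>) * (1 + t) = 1"
    using t(1) by (auto simp: \<theta>_def field_simps)
  define y where "y = y\<^sub>1 - \<theta> *\<^sub>R (y\<^sub>1 - y\<^sub>0)"
  define s where "s = s\<^sub>1 - \<theta> *\<^sub>R (s\<^sub>1 - s\<^sub>0)"
  have s: "s \<in> interior (prod_cone Q)"
    unfolding s_def
    using mem_interior_convex_shrink[OF convex_prod_cone slater(2) d1(2) \<theta>(1,2)] .
  have "transpose (coeff_mat Q) *v y + s
      = (1 - \<theta>) *\<^sub>R (transpose (coeff_mat Q) *v y\<^sub>1 + s\<^sub>1) + \<theta> *\<^sub>R (transpose (coeff_mat Q) *v y\<^sub>0 + s\<^sub>0)"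
    by (simp add: y_def s_def matrix_vector_mult_diff_distrib matrix_vector_mult_scaleR algebra_simps)
  also have "\<dots> = cost Q + ((1 - \<theta>) * (1 + t) * \<epsilon>) *\<^sub>R cost_dir Q"
    unfolding d0 d1 cost_at_def by (simp add: algebra_simps)
  also have "\<dots> = cost_at Q \<epsilon>"
    by (simp add: \<theta>(3) cost_at_def)
  finally have "(y, s) \<in> dual_feasible Q \<epsilon>"
    using s interior_subset by (auto simp: dual_feasible_def)
  with s that show ?thesis by blast
qed

section \<open>Complementarity\<close>

text \<open>
  The optimal values agree, so \<open>x \<bullet> s = 0\<close>; this is a sum of nonnegative contributions of the blocks.
\<close>

lemma complementarity:
  assumes x: "x \<in> primal_opt Q \<epsilon>" and ys: "(y, s) \<in> dual_opt Q \<epsilon>"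
  shows "block Q i x \<bullet> block Q i s = 0"
proof -
  have x': "x \<in> primal_feasible Q" and s': "(y, s) \<in> dual_feasible Q \<epsilon>"
    using x ys by (auto simp: primal_opt_def dual_opt_def)
  have cone: "x \<in> prod_cone Q" "s \<in> prod_cone Q"
    using x' s' by (auto simp: primal_feasible_def dual_feasible_def)
  have "ereal (cost_at Q \<epsilon> \<bullet> x) = ereal (rhs Q \<bullet> y)"
    using x ys by (simp add: primal_opt_def dual_opt_def)
  then have "(\<Sum>i\<in>UNIV. block Q i x \<bullet> block Q i s) = 0"
    using feasible_gap[OF x' s'] by (simp add: inner_commute flip: inner_eq_sum_blocks)
  then show ?thesis
    by (subst (asm) sum_nonneg_eq_0_iff) (auto intro: inner_soc_nonneg prod_coneD cone)
qed

text \<open>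
  If one of the two blocks were interior, its inner product with the other, nonzero one would be
  positive.
\<close>

lemma complementary_blocks:
  assumes x: "x \<in> primal_opt Q \<epsilon>" and ys: "(y, s) \<in> dual_opt Q \<epsilon>"
    and nz: "block Q i x \<noteq> 0" "block Q i s \<noteq> 0"
  shows "block Q i x \<in> soc_bd (lead Q i) - {0} \<and> block Q i s \<in> soc_bd (lead Q i) - {0}"
proof -
  have cone: "block Q i x \<in> soc (lead Q i)" "block Q i s \<in> soc (lead Q i)"
    using x ys
    by (auto simp: primal_opt_def dual_opt_def primal_feasible_def dual_feasible_def prod_coneD)
  have "block Q i x \<notin> soc_int (lead Q i)"
    using inner_soc_int_pos[OF _ cone(2) nz(2)] complementarity[OF x ys, of i] by force
  moreover have "block Q i s \<notin> soc_int (lead Q i)"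
    using inner_soc_int_pos[OF _ cone(1) nz(1)] complementarity[OF x ys, of i]
    by (force simp: inner_commute)
  ultimately show ?thesis
    using cone nz soc_int_or_bd by blast
qed

section \<open>Stability of the optimal partition\<close>

text \<open>
  The passage from sequences to neighbourhoods: with \<open>a\<close> interior to \<open>\<Gamma>\<close>, the sequential condition
  controls every parameter close to \<open>a\<close>.
\<close>

lemma inner_semicont_at_eventually_meets:
  assumes "inner_semicont_at \<Phi> \<Gamma> a" "a \<in> interior \<Gamma>" "l \<in> \<Phi> a" "open U" "l \<in> U"
  shows "\<forall>\<^sub>F e in nhds a. \<exists>x\<in>\<Phi> e. x \<in> U"
proof -
  have "\<forall>\<^sub>F e in inf (nhds a) (principal \<Gamma>). \<exists>x\<in>\<Phi> e. x \<in> U"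
  proof (rule sequentially_imp_eventually_nhds_within, intro allI impI)
    fix e :: "nat \<Rightarrow> real"
    assume "(\<forall>n. e n \<in> \<Gamma>) \<and> e \<longlonglongrightarrow> a"
    with assms(1,3) obtain x where "\<And>k. x k \<in> \<Phi> (e k)" and lim: "x \<longlonglongrightarrow> l"
      unfolding inner_semicont_at_def by blast
    moreover have "\<forall>\<^sub>F n in sequentially. x n \<in> U"
      using topological_tendstoD[OF lim assms(4,5)] .
    ultimately show "\<forall>\<^sub>F n in sequentially. \<exists>x\<in>\<Phi> (e n). x \<in> U"
      by (metis (mono_tags, lifting) eventually_mono)
  qed
  moreover have "\<forall>\<^sub>F e in nhds a. e \<in> \<Gamma>"
    using assms(2) eventually_nhds_in_open[OF open_interior] interior_subset
    by (metis (mono_tags, lifting) eventually_mono subsetD)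
  ultimately show ?thesis
    by (auto simp: eventually_inf_principal elim: eventually_elim2)
qed

theorem lemma3:
  fixes Q :: "('m::finite, 'n::finite, 'p::finite) socp" and \<epsilon>\<^sub>0 :: real
  assumes lead_in_block: "\<And>i. blk Q (lead Q i) = i"
    and cost_dir_nonzero: "cost_dir Q \<noteq> 0"
    and full_row_rank: "rank (coeff_mat Q) = CARD('m)"
    and strictly_feasible:
      "\<exists>x\<in>primal_feasible Q. \<exists>(y, s)\<in>dual_feasible Q 0.
         \<forall>i. block Q i x \<in> soc_int (lead Q i) \<and> block Q i s \<in> soc_int (lead Q i)"
    and eps0: "\<epsilon>\<^sub>0 \<in> interior (finite_dom Q)"
    and primal_cont: "pk_continuous_at (primal_opt Q) (interior (finite_dom Q)) \<epsilon>\<^sub>0"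
    and dual_cont: "pk_continuous_at (dual_opt Q) (interior (finite_dom Q)) \<epsilon>\<^sub>0"
  shows "\<exists>\<delta>>0. \<forall>\<epsilon>. \<bar>\<epsilon> - \<epsilon>\<^sub>0\<bar> < \<delta> \<longrightarrow>
           part_B Q \<epsilon>\<^sub>0 \<subseteq> part_B Q \<epsilon> \<and>
           part_N Q \<epsilon>\<^sub>0 \<subseteq> part_N Q \<epsilon> \<and>
           part_R Q \<epsilon>\<^sub>0 \<subseteq> part_R Q \<epsilon> \<and>
           part_T Q \<epsilon> \<subseteq> part_T Q \<epsilon>\<^sub>0 \<and>
           part_T2 Q \<epsilon>\<^sub>0 \<inter> (part_N Q \<epsilon> \<union> part_T1 Q \<epsilon> \<union> part_T3 Q \<epsilon>) = {} \<and>
           part_T3 Q \<epsilon>\<^sub>0 \<inter> (part_B Q \<epsilon> \<union> part_T1 Q \<epsilon> \<union> part_T2 Q \<epsilon>) = {}"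
proof -
  obtain x\<^sub>0 y\<^sub>0 s\<^sub>0 where x0: "x\<^sub>0 \<in> primal_feasible Q" "x\<^sub>0 \<in> interior (prod_cone Q)"
    and s0: "(y\<^sub>0, s\<^sub>0) \<in> dual_feasible Q 0" "s\<^sub>0 \<in> interior (prod_cone Q)"
    using strictly_feasible interior_prod_coneI by (metis (mono_tags, lifting) case_prodE)
  have dual_ne: "dual_opt Q \<epsilon> \<noteq> {}" if "\<epsilon> \<in> finite_dom Q" for \<epsilon>
    using dual_opt_nonempty[OF lead_in_block full_row_rank x0 that] .
  have dual_feas: "dual_feasible Q \<epsilon> \<noteq> {}" if "\<epsilon> \<in> finite_dom Q" for \<epsilon>
    using dual_ne[OF that] by (auto simp: dual_opt_def)
  have primal_ne: "primal_opt Q \<epsilon> \<noteq> {}" if "\<epsilon> \<in> interior (finite_dom Q)" for \<epsilon>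
    using dual_interior_feasible[OF dual_feas s0 that] primal_opt_nonempty_if_dual_interior x0(1)
    by (metis empty_iff)
  have near: "\<forall>\<^sub>F \<epsilon> in nhds \<epsilon>\<^sub>0. \<epsilon> \<in> interior (finite_dom Q)"
    using eps0 by (intro eventually_nhds_in_open open_interior)
  have primal_near: "\<forall>\<^sub>F \<epsilon> in nhds \<epsilon>\<^sub>0. \<exists>x\<in>primal_opt Q \<epsilon>. x \<in> U"
    if "x \<in> primal_opt Q \<epsilon>\<^sub>0" "open U" "x \<in> U" for x U
    using primal_cont eps0 that
    by (intro inner_semicont_at_eventually_meets[of _ "interior (finite_dom Q)"])
       (auto simp: pk_continuous_at_def)
  have dual_near: "\<forall>\<^sub>F \<epsilon> in nhds \<epsilon>\<^sub>0. \<exists>(y, s)\<in>dual_opt Q \<epsilon>. s \<in> U"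
    if "(y, s) \<in> dual_opt Q \<epsilon>\<^sub>0" "open U" "s \<in> U" for y s U
  proof -
    have "\<forall>\<^sub>F \<epsilon> in nhds \<epsilon>\<^sub>0. \<exists>z\<in>dual_opt Q \<epsilon>. z \<in> UNIV \<times> U"
      using dual_cont eps0 that
      by (intro inner_semicont_at_eventually_meets[of _ "interior (finite_dom Q)"])
         (auto simp: pk_continuous_at_def intro: open_Times)
    then show ?thesis by (rule eventually_mono) auto
  qed
  have ev_B: "\<forall>\<^sub>F \<epsilon> in nhds \<epsilon>\<^sub>0. i \<in> part_B Q \<epsilon>\<^sub>0 \<longrightarrow> i \<in> part_B Q \<epsilon>" for i
  proof (cases "i \<in> part_B Q \<epsilon>\<^sub>0")
    case True
    then obtain x where "x \<in> primal_opt Q \<epsilon>\<^sub>0" "block Q i x \<in> soc_int (lead Q i)"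
      by (auto simp: part_B_def)
    then show ?thesis
      using primal_near[OF _ open_block_soc_int[of Q i]] by (auto simp: part_B_def)
  qed simp
  have ev_N: "\<forall>\<^sub>F \<epsilon> in nhds \<epsilon>\<^sub>0. i \<in> part_N Q \<epsilon>\<^sub>0 \<longrightarrow> i \<in> part_N Q \<epsilon>" for i
  proof (cases "i \<in> part_N Q \<epsilon>\<^sub>0")
    case True
    then obtain y s where "(y, s) \<in> dual_opt Q \<epsilon>\<^sub>0" "block Q i s \<in> soc_int (lead Q i)"
      by (auto simp: part_N_def)
    then show ?thesis
      using dual_near[OF _ open_block_soc_int[of Q i]] by (auto simp: part_N_def)
  qed simp
  have ev_x: "\<forall>\<^sub>F \<epsilon> in nhds \<epsilon>\<^sub>0. (\<exists>x\<in>primal_opt Q \<epsilon>\<^sub>0. block Q i x \<noteq> 0) \<longrightarrow>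
      (\<exists>x\<in>primal_opt Q \<epsilon>. block Q i x \<noteq> 0)" for i
  proof (cases "\<exists>x\<in>primal_opt Q \<epsilon>\<^sub>0. block Q i x \<noteq> 0")
    case True
    then show ?thesis using primal_near[OF _ open_block_nonzero[of Q i]] by auto
  qed simp
  have ev_s: "\<forall>\<^sub>F \<epsilon> in nhds \<epsilon>\<^sub>0. (\<exists>(y, s)\<in>dual_opt Q \<epsilon>\<^sub>0. block Q i s \<noteq> 0) \<longrightarrow>
      (\<exists>(y, s)\<in>dual_opt Q \<epsilon>. block Q i s \<noteq> 0)" for i
  proof (cases "\<exists>(y, s)\<in>dual_opt Q \<epsilon>\<^sub>0. block Q i s \<noteq> 0")
    case True
    then show ?thesis using dual_near[OF _ open_block_nonzero[of Q i]] by auto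
  qed simp
  have "\<forall>\<^sub>F \<epsilon> in nhds \<epsilon>\<^sub>0. \<epsilon> \<in> interior (finite_dom Q) \<and> (\<forall>i.
      (i \<in> part_B Q \<epsilon>\<^sub>0 \<longrightarrow> i \<in> part_B Q \<epsilon>) \<and> (i \<in> part_N Q \<epsilon>\<^sub>0 \<longrightarrow> i \<in> part_N Q \<epsilon>) \<and>
      ((\<exists>x\<in>primal_opt Q \<epsilon>\<^sub>0. block Q i x \<noteq> 0) \<longrightarrow> (\<exists>x\<in>primal_opt Q \<epsilon>. block Q i x \<noteq> 0)) \<and>
      ((\<exists>(y, s)\<in>dual_opt Q \<epsilon>\<^sub>0. block Q i s \<noteq> 0) \<longrightarrow>
        (\<exists>(y, s)\<in>dual_opt Q \<epsilon>. block Q i s \<noteq> 0)))"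
    by (intro eventually_conj near eventually_all_finite ev_B ev_N ev_x ev_s)
  then obtain \<delta> where "0 < \<delta>" and \<delta>: "\<And>\<epsilon>. \<bar>\<epsilon> - \<epsilon>\<^sub>0\<bar> < \<delta> \<Longrightarrow> \<epsilon> \<in> interior (finite_dom Q) \<and> (\<forall>i.
      (i \<in> part_B Q \<epsilon>\<^sub>0 \<longrightarrow> i \<in> part_B Q \<epsilon>) \<and> (i \<in> part_N Q \<epsilon>\<^sub>0 \<longrightarrow> i \<in> part_N Q \<epsilon>) \<and>
      ((\<exists>x\<in>primal_opt Q \<epsilon>\<^sub>0. block Q i x \<noteq> 0) \<longrightarrow> (\<exists>x\<in>primal_opt Q \<epsilon>. block Q i x \<noteq> 0)) \<and>
      ((\<exists>(y, s)\<in>dual_opt Q \<epsilon>\<^sub>0. block Q i s \<noteq> 0) \<longrightarrow>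
        (\<exists>(y, s)\<in>dual_opt Q \<epsilon>. block Q i s \<noteq> 0)))"
    unfolding eventually_nhds_metric dist_real_def by blast
  show ?thesis
  proof (intro exI[of _ \<delta>] conjI allI impI \<open>0 < \<delta>\<close>)
    fix \<epsilon> assume "\<bar>\<epsilon> - \<epsilon>\<^sub>0\<bar> < \<delta>"
    note at = \<delta>[OF this]
    have P: "primal_opt Q \<epsilon> \<noteq> {}" and D: "dual_opt Q \<epsilon> \<noteq> {}"
      using at primal_ne dual_ne interior_subset by blast+
    \<comment> \<open>The conditions defining \<open>\<R>\<close>, \<open>\<T>\<^sub>2\<close> and \<open>\<T>\<^sub>3\<close> enter only through these nonzero blocks.\<close>
    have x_near: "\<exists>x\<in>primal_opt Q \<epsilon>. block Q i x \<noteq> 0"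
      if "\<exists>x\<in>primal_opt Q \<epsilon>\<^sub>0. block Q i x \<noteq> 0" for i
      using at that by blast
    have s_near: "\<exists>(y, s)\<in>dual_opt Q \<epsilon>. block Q i s \<noteq> 0"
      if "\<exists>(y, s)\<in>dual_opt Q \<epsilon>\<^sub>0. block Q i s \<noteq> 0" for i
      using at that by blast
    show B: "part_B Q \<epsilon>\<^sub>0 \<subseteq> part_B Q \<epsilon>" and N: "part_N Q \<epsilon>\<^sub>0 \<subseteq> part_N Q \<epsilon>"
      using at by blast+
    show R: "part_R Q \<epsilon>\<^sub>0 \<subseteq> part_R Q \<epsilon>"
    proof
      fix i assume "i \<in> part_R Q \<epsilon>\<^sub>0"
      then have "\<exists>x\<in>primal_opt Q \<epsilon>. block Q i x \<noteq> 0"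
        "\<exists>(y, s)\<in>dual_opt Q \<epsilon>. block Q i s \<noteq> 0"
        by (intro x_near s_near; force simp: part_R_def)+
      then show "i \<in> part_R Q \<epsilon>"
        unfolding part_R_def using complementary_blocks[of _ Q \<epsilon> _ _ i] by fast
    qed
    show "part_T Q \<epsilon> \<subseteq> part_T Q \<epsilon>\<^sub>0"
      using B N R by (auto simp: part_T_def)
    show "part_T2 Q \<epsilon>\<^sub>0 \<inter> (part_N Q \<epsilon> \<union> part_T1 Q \<epsilon> \<union> part_T3 Q \<epsilon>) = {}"
    proof (rule equals0I)
      fix i assume i: "i \<in> part_T2 Q \<epsilon>\<^sub>0 \<inter> (part_N Q \<epsilon> \<union> part_T1 Q \<epsilon> \<union> part_T3 Q \<epsilon>)"
      then obtain x where x: "x \<in> primal_opt Q \<epsilon>" "block Q i x \<noteq> 0"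
        using x_near[of i] by (auto simp: part_T2_def)
      then have "i \<notin> part_T1 Q \<epsilon> \<union> part_T3 Q \<epsilon>"
        using D by (force simp: part_T1_def part_T3_def)
      moreover have "i \<notin> part_N Q \<epsilon>"
        using complementary_blocks[OF x(1) _ x(2)] soc_int_nonzero soc_int_bd_disjoint
        by (fastforce simp: part_N_def)
      ultimately show False using i by blast
    qed
    show "part_T3 Q \<epsilon>\<^sub>0 \<inter> (part_B Q \<epsilon> \<union> part_T1 Q \<epsilon> \<union> part_T2 Q \<epsilon>) = {}"
    proof (rule equals0I)
      fix i assume i: "i \<in> part_T3 Q \<epsilon>\<^sub>0 \<inter> (part_B Q \<epsilon> \<union> part_T1 Q \<epsilon> \<union> part_T2 Q \<epsilon>)"
      then obtain y s where s: "(y, s) \<in> dual_opt Q \<epsilon>" "block Q i s \<noteq> 0"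
        using s_near[of i] by (auto simp: part_T3_def)
      then have "i \<notin> part_T1 Q \<epsilon> \<union> part_T2 Q \<epsilon>"
        using P by (force simp: part_T1_def part_T2_def)
      moreover have "i \<notin> part_B Q \<epsilon>"
        using complementary_blocks[OF _ s(1) _ s(2)] soc_int_nonzero soc_int_bd_disjoint
        by (fastforce simp: part_B_def)
      ultimately show False using i by blast
    qed
  qed
qed

end
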